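(* Let $\Omega \subset \mathbb{R}^2 = \mathbb{C}$ be a bounded domain whose boundary is locally the graph of a Lipschitz function, let $k$ be a complex parameter, and define the operator $AB$ by $$ ABu(z) = \frac{1}{4\pi^2} \iint_{\Omega\times\Omega} \frac{e^{-k(\zeta-w)+\bar k(\bar\zeta-\bar w)}}{(z-\zeta)(\bar\zeta-\bar w)}\, u(w)\, dm(w)\, dm(\zeta). $$ Then the operator $AB$ satisfies the estimates $$ \|ABu\|_{L^p} \le C\,\|u\|_{L^p}, \qquad 2<p<\infty, $$ $$ \|ABu\|_{\langle\cdot\rangle^{\epsilon}L^p} \le C\,\|u\|_{L^p}, \qquad 1<p\le 2,\ \epsilon>2/p-1, $$ where in each estimate $C$ is a finite constant independent of $u$.
   Context: $\mathbb{R}^2$ is identified with $\mathbb{C}$, and $dm$ denotes Lebesgue measure on the plane. $L^p$ means $L^p(\mathbb{R}^2)$. Write $\langle x\rangle=(1+|x|^2)^{1/2}$. For $\epsilon\in\mathbb{R}$, $\langle\cdot\rangle^{\epsilon}L^p$ is the collection of functions $f$ on $\mathbb{R}^2$ with $\langle\cdot\rangle^{-\epsilon}f\in L^p(\mathbb{R}^2)$, with norm $\|f\|_{\langle\cdot\rangle^{\epsilon}L^p}=\|\langle\cdot\rangle^{-\epsilon}f\|_{L^p(\mathbb{R}^2)}$. *)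

theory Defs
  imports "HOL-Analysis.Analysis"
begin

text \<open>
  The plane is the type \<^typ>\<open>complex\<close>, and \<open>dm\<close> is \<open>lebesgue :: complex measure\<close>. Elements of
  \<open>L\<^sup>p\<close> are represented by functions, not by equivalence classes modulo null sets.
\<close>

definition Lp :: "real \<Rightarrow> (complex \<Rightarrow> complex) set" where
  "Lp p = {f. f \<in> borel_measurable lebesgue \<and> integrable lebesgue (\<lambda>z. norm (f z) powr p)}"

definition Lp_norm :: "real \<Rightarrow> (complex \<Rightarrow> complex) \<Rightarrow> real" where
  "Lp_norm p f = (\<integral>z. norm (f z) powr p \<partial>lebesgue) powr (1 / p)"

definition japanese_bracket :: "complex \<Rightarrow> real" where
  "japanese_bracket z = sqrt (1 + (norm z)\<^sup>2)"

definition weighted_Lp :: "real \<Rightarrow> real \<Rightarrow> (complex \<Rightarrow> complex) set" where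
  "weighted_Lp \<epsilon> p = {f. (\<lambda>z. of_real (japanese_bracket z powr (- \<epsilon>)) * f z) \<in> Lp p}"

definition weighted_Lp_norm :: "real \<Rightarrow> real \<Rightarrow> (complex \<Rightarrow> complex) \<Rightarrow> real" where
  "weighted_Lp_norm \<epsilon> p f = Lp_norm p (\<lambda>z. of_real (japanese_bracket z powr (- \<epsilon>)) * f z)"

text \<open>
  Locally the graph of a Lipschitz function, in coordinates rotated by the unit number \<open>c\<close>. A
  translation of the coordinates can be absorbed into \<open>g\<close>, and a Lipschitz function on an interval
  extends to the whole line, so \<open>g\<close> is taken on \<open>UNIV\<close>.
\<close>

definition locally_Lipschitz_graph :: "complex set \<Rightarrow> bool" where
  "locally_Lipschitz_graph S \<longleftrightarrow>
     (\<forall>z\<in>S. \<exists>U c (g :: real \<Rightarrow> real) L.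
        open U \<and> z \<in> U \<and> norm c = 1 \<and> L-lipschitz_on UNIV g \<and>
        S \<inter> U = range (\<lambda>t. c * Complex t (g t)) \<inter> U)"

text \<open>
  The first component of the pair is \<open>\<zeta>\<close>, the second is \<open>w\<close>. Division by zero yields zero in HOL, so
  the integrand takes the value 0 on the null sets \<open>\<zeta> = z\<close> and \<open>\<zeta> = w\<close>.
\<close>

definition AB_integrand :: "complex \<Rightarrow> (complex \<Rightarrow> complex) \<Rightarrow> complex \<Rightarrow> complex \<times> complex \<Rightarrow> complex" where
  "AB_integrand k u z = (\<lambda>(\<zeta>, w).
     exp (- k * (\<zeta> - w) + cnj k * (cnj \<zeta> - cnj w)) / ((z - \<zeta>) * (cnj \<zeta> - cnj w)) * u w)"

definition AB :: "complex set \<Rightarrow> complex \<Rightarrow> (complex \<Rightarrow> complex) \<Rightarrow> complex \<Rightarrow> complex" where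
  "AB \<Omega> k u z =
     1 / (4 * of_real pi ^ 2) *
       set_lebesgue_integral (lebesgue \<Otimes>\<^sub>M lebesgue) (\<Omega> \<times> \<Omega>) (AB_integrand k u z)"

text \<open>
  The Bochner integral of a non-integrable function is 0 by convention; this predicate expresses that
  the double integral above converges absolutely for almost every \<open>z\<close>.
\<close>

definition AB_well_defined :: "complex set \<Rightarrow> complex \<Rightarrow> (complex \<Rightarrow> complex) \<Rightarrow> bool" where
  "AB_well_defined \<Omega> k u \<longleftrightarrow>
     (AE z in lebesgue. set_integrable (lebesgue \<Otimes>\<^sub>M lebesgue) (\<Omega> \<times> \<Omega>) (AB_integrand k u z))"

end

theory Submission
  imports Defs
begin

text \<open>
  The exponential has modulus 1, so \<open>ABu\<close> is dominated by the integral of \<open>\<bar>u(w)\<bar>\<close> against the kernel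
  \<open>1 / (\<bar>z - \<zeta>\<bar> \<bar>\<zeta> - w\<bar>)\<close> on \<open>\<Omega> \<times> \<Omega>\<close>, whose total mass is \<open>O(\<langle>z\<rangle>\<^sup>-\<^sup>1)\<close> because \<open>\<Omega>\<close> is bounded. Hoelder's
  inequality bounds \<open>\<bar>ABu(z)\<bar>\<^sup>p\<close> by \<open>\<langle>z\<rangle>\<close> to the power \<open>-(p - 1)\<close> times the integral of \<open>\<bar>u(w)\<bar>\<^sup>p\<close> against
  the same kernel. Multiply by \<open>\<langle>z\<rangle>\<close> to the power \<open>-\<epsilon>p\<close> and integrate in \<open>z\<close> first: the
  \<open>z\<close>-integrand decays like \<open>\<langle>z\<rangle>\<close> to the power \<open>-p(1 + \<epsilon>)\<close>, so this integral is bounded uniformly in \<open>\<zeta>\<close>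
  exactly when \<open>p(1 + \<epsilon>) > 2\<close>. For \<open>p > 2\<close> the weight \<open>\<epsilon> = 0\<close> is admissible.
\<close>

section \<open>Lebesgue measure as a sigma-finite measure, and Hoelder's inequality\<close>

lemma sigma_finite_lebesgue: "sigma_finite_measure (lebesgue :: 'a::euclidean_space measure)"
proof
  obtain A :: "'a set set" where A: "countable A" "A \<subseteq> sets lborel" "\<Union>A = space lborel"
    "\<forall>a\<in>A. emeasure lborel a \<noteq> \<infinity>"
    using lborel.sigma_finite_countable by blast
  show "\<exists>A::'a set set. countable A \<and> A \<subseteq> sets lebesgue \<and> \<Union>A = space lebesgue \<and>
      (\<forall>a\<in>A. emeasure lebesgue a \<noteq> \<infinity>)"
    by (rule exI[of _ A]) (use A in \<open>auto simp: subset_iff\<close>)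
qed

interpretation lebesgue: sigma_finite_measure "lebesgue :: 'a::euclidean_space measure"
  by (rule sigma_finite_lebesgue)

text \<open>Composing with this map makes every Borel function measurable for the completed measure,
  so brackets and kernels can be handled by the measurability prover.\<close>

lemma id_lebesgue_borel [measurable]: "(\<lambda>x. x) \<in> (lebesgue :: 'a::euclidean_space measure) \<rightarrow>\<^sub>M borel"
  by (auto intro!: measurable_completion)

text \<open>
  Hoelder's inequality up to a factor 2, obtained by integrating \<open>f \<le> t + t\<^sup>1\<^sup>-\<^sup>p f\<^sup>p\<close> against \<open>w\<close> and
  optimising in \<open>t\<close>.
\<close>

lemma nn_integral_mult_powr_le:
  fixes f w :: "'a \<Rightarrow> real"
  assumes [measurable]: "f \<in> borel_measurable M" "w \<in> borel_measurable M"
    and f: "\<And>x. 0 \<le> f x" and w: "\<And>x. 0 \<le> w x" and p: "1 < p" and D: "0 < D" and I: "0 \<le> I"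
    and wD: "(\<integral>\<^sup>+x. ennreal (w x) \<partial>M) \<le> ennreal D"
    and fI: "(\<integral>\<^sup>+x. ennreal (w x * f x powr p) \<partial>M) \<le> ennreal I"
  shows "(\<integral>\<^sup>+x. ennreal (w x * f x) \<partial>M) \<le> ennreal (2 * D powr (1 - 1 / p) * I powr (1 / p))"
proof -
  have split: "(\<integral>\<^sup>+x. ennreal (w x * f x) \<partial>M) \<le> ennreal (t * D + t powr (1 - p) * I)" if t: "0 < t" for t
  proof -
    have pw: "f x \<le> t + t powr (1 - p) * f x powr p" for x
    proof (cases "f x \<le> t")
      \<comment> \<open>Above the level \<open>t\<close>, the negative exponent \<open>1 - p\<close>
        makes \<open>f x powr (1 - p)\<close> at most \<open>t powr (1 - p)\<close>.\<close>
      case False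
      then have "f x = f x powr (1 - p) * f x powr p"
        using t by (simp flip: powr_add)
      also have "\<dots> \<le> t powr (1 - p) * f x powr p"
        using False t p by (intro mult_right_mono powr_mono2') auto
      finally show ?thesis using t by simp
    qed (simp add: add_increasing2)
    have "(\<integral>\<^sup>+x. ennreal (w x * f x) \<partial>M) \<le>
        (\<integral>\<^sup>+x. ennreal t * ennreal (w x) + ennreal (t powr (1 - p)) * ennreal (w x * f x powr p) \<partial>M)"
    proof (rule nn_integral_mono)
      fix x
      have "w x * f x \<le> w x * (t + t powr (1 - p) * f x powr p)"
        by (rule mult_left_mono[OF pw w])
      also have "\<dots> = t * w x + t powr (1 - p) * (w x * f x powr p)"
        by (simp add: algebra_simps)
      finally show "ennreal (w x * f x) \<le> ennreal t * ennreal (w x) + ennreal (t powr (1 - p)) * ennreal (w x * f x powr p)"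
        using t w by (simp flip: ennreal_mult ennreal_plus)
    qed
    also have "\<dots> = ennreal t * (\<integral>\<^sup>+x. ennreal (w x) \<partial>M) + ennreal (t powr (1 - p)) * (\<integral>\<^sup>+x. ennreal (w x * f x powr p) \<partial>M)"
      by (simp add: nn_integral_add nn_integral_cmult)
    also have "\<dots> \<le> ennreal t * ennreal D + ennreal (t powr (1 - p)) * ennreal I"
      by (intro add_mono mult_left_mono wD fI) auto
    also have "\<dots> = ennreal (t * D + t powr (1 - p) * I)"
      using t D I by (simp add: ennreal_mult)
    finally show ?thesis .
  qed
  show ?thesis
  proof (cases "I = 0")
    \<comment> \<open>With \<open>I = 0\<close> only \<open>t * D\<close> remains; the choice
      \<open>t = e / D\<close> makes it an arbitrary \<open>e > 0\<close>.\<close>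
    case True
    have "(\<integral>\<^sup>+x. ennreal (w x * f x) \<partial>M) \<le> 0"
    proof (rule ennreal_le_epsilon)
      fix e :: real assume "0 < e"
      then show "(\<integral>\<^sup>+x. ennreal (w x * f x) \<partial>M) \<le> 0 + ennreal e"
        using split[of "e / D"] D True by simp
    qed
    then show ?thesis by simp
  next
    case False
    then have I: "0 < I" using I by simp
    \<comment> \<open>This \<open>t\<close> balances the two terms: each equals
      \<open>D powr (1 - 1 / p) * I powr (1 / p)\<close>, whence the factor 2.\<close>
    define t where "t = (I / D) powr (1 / p)"
    have t: "0 < t" using I D by (simp add: t_def)
    have "t * D = I powr (1 / p) * (D powr (- (1 / p)) * D powr 1)"
      using I D by (simp add: t_def powr_divide powr_minus field_simps)
    also have "\<dots> = I powr (1 / p) * D powr (1 - 1 / p)"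
      unfolding powr_add[symmetric] by simp
    finally have 1: "t * D = D powr (1 - 1 / p) * I powr (1 / p)" by simp
    have "1 / p * (1 - p) = 1 / p - 1" using p by (simp add: field_simps)
    then have "t powr (1 - p) * I = (I / D) powr (1 / p - 1) * I"
      unfolding t_def powr_powr by simp
    also have "\<dots> = (I powr (1 / p - 1) * I powr 1) * D powr (- (1 / p - 1))"
      unfolding powr_minus using I D by (simp add: powr_divide field_simps)
    also have "\<dots> = D powr (1 - 1 / p) * I powr (1 / p)"
      unfolding powr_add[symmetric] by simp
    finally show ?thesis using split[OF t] 1 by (simp add: mult_ac)
  qed
qed

section \<open>The Japanese bracket and dyadic scales\<close>

lemma japanese_bracket_ge_1: "1 \<le> japanese_bracket z"
  by (simp add: japanese_bracket_def)

lemma japanese_bracket_pos: "0 < japanese_bracket z"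
  using japanese_bracket_ge_1[of z] by linarith

lemma norm_le_japanese_bracket: "norm z \<le> japanese_bracket z"
  unfolding japanese_bracket_def by (rule real_le_rsqrt) simp

lemma japanese_bracket_le: "japanese_bracket z \<le> 1 + norm z"
  unfolding japanese_bracket_def by (rule real_le_lsqrt) (auto simp: power2_eq_square algebra_simps)

lemma japanese_bracket_measurable [measurable]: "japanese_bracket \<in> borel_measurable borel"
  unfolding japanese_bracket_def by measurable

lemma emeasure_lborel_cball_complex:
  fixes c :: complex
  assumes "0 \<le> r"
  shows "emeasure lborel (cball c r) = ennreal (pi * r\<^sup>2)"
  using emeasure_cball[OF assms, of c] by (simp add: unit_ball_vol_2)

lemma dyadic_bracket:
  fixes x :: real
  assumes "1 \<le> x"
  obtains n :: nat where "2 ^ n \<le> x" "x < 2 ^ Suc n"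
proof -
  \<comment> \<open>Minimality gives \<open>2 ^ n \<le> x\<close> for positive \<open>n\<close>; for
    \<open>n = 0\<close> it is the hypothesis.\<close>
  define n where "n = (LEAST n. x < 2 ^ Suc n)"
  obtain m where "x < 2 ^ m" using real_arch_pow[of 2 x] by auto
  then have "x < 2 ^ Suc m" using assms by simp
  then have 1: "x < 2 ^ Suc n" unfolding n_def by (rule LeastI)
  have "2 ^ n \<le> x"
  proof (cases n)
    case (Suc m)
    then have "\<not> x < 2 ^ Suc m" using not_less_Least[of m "\<lambda>n. x < 2 ^ Suc n"] by (simp add: n_def)
    then show ?thesis using Suc by simp
  qed (use assms in simp)
  then show thesis using 1 by (rule that)
qed

section \<open>Planar integrals by dyadic summation\<close>

lemma ennreal_le_suminf: "f n \<le> (\<Sum>n. f n)" for f :: "nat \<Rightarrow> ennreal"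
  using sum_le_suminf[of f "{n}"] by simp

lemma suminf_geometric_finite:
  fixes f :: "nat \<Rightarrow> ennreal"
  assumes "\<And>n. f n = ennreal (C * r ^ n)" "0 \<le> C" "0 \<le> r" "r < 1"
  shows "(\<Sum>n. f n) < \<infinity>"
proof -
  have "summable (\<lambda>n. C * r ^ n)" using assms by (intro summable_mult summable_geometric) auto
  then have "(\<Sum>n. ennreal (C * r ^ n)) \<noteq> top"
    using assms by (intro ennreal_suminf_neq_top) auto
  then show ?thesis using assms by (simp add: less_top)
qed

text \<open>Where \<open>1 / norm (z - c)\<close> lies between \<open>2 ^ n\<close> and
  \<open>2 ^ Suc n\<close>, the point lies in the disc of radius \<open>(1 / 2) ^ n\<close>, of area
  \<open>pi / 4 ^ n\<close>. The resulting series is geometric with ratio 1/2, and disc areas do not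
  depend on the centre, so one \<open>H\<close> serves all \<open>c\<close>.\<close>

lemma nn_integral_inverse_dist_ball_finite:
  "\<exists>H\<ge>0. \<forall>c::complex. (\<integral>\<^sup>+z. ennreal (indicator (ball c 1) z / norm (z - c)) \<partial>lborel) \<le> ennreal H"
proof -
  define H where "H = (\<Sum>n. ennreal (2 ^ Suc n) * ennreal (pi * ((1 / 2) ^ n)\<^sup>2))"
  have "H < \<infinity>"
    unfolding H_def
  proof (rule suminf_geometric_finite)
    fix n :: nat
    have "(2::real) ^ Suc n * (pi * ((1 / 2) ^ n)\<^sup>2) = 2 * pi * (1 / 2) ^ n"
      by (simp add: power_divide power2_eq_square field_simps)
    then show "ennreal (2 ^ Suc n) * ennreal (pi * ((1 / 2) ^ n)\<^sup>2) = ennreal (2 * pi * (1 / 2) ^ n)"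
      by (simp flip: ennreal_mult)
  qed auto
  moreover have "(\<integral>\<^sup>+z. ennreal (indicator (ball c 1) z / norm (z - c)) \<partial>lborel) \<le> H" for c :: complex
  proof -
    have "(\<integral>\<^sup>+z. ennreal (indicator (ball c 1) z / norm (z - c)) \<partial>lborel) \<le>
        (\<integral>\<^sup>+z. (\<Sum>n. ennreal (2 ^ Suc n) * indicator (cball c ((1 / 2) ^ n)) z) \<partial>lborel)"
    proof (rule nn_integral_mono)
      fix z :: complex
      show "ennreal (indicator (ball c 1) z / norm (z - c)) \<le>
          (\<Sum>n. ennreal (2 ^ Suc n) * indicator (cball c ((1 / 2) ^ n)) z)"
      \<comment> \<open>At \<open>z = c\<close> the quotient is 0 in HOL, so the singular point
        needs no dyadic scale.\<close>
      proof (cases "z \<in> ball c 1 \<and> z \<noteq> c")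
        case True
        then have d: "0 < norm (z - c)" "norm (z - c) < 1"
          by (auto simp: dist_norm norm_minus_commute)
        then obtain n :: nat where n: "2 ^ n \<le> 1 / norm (z - c)" "1 / norm (z - c) < 2 ^ Suc n"
          using dyadic_bracket[of "1 / norm (z - c)"] by auto
        from n(1) d have "z \<in> cball c ((1 / 2) ^ n)"
          by (simp add: dist_norm norm_minus_commute field_simps power_divide)
        then have "ennreal (indicator (ball c 1) z / norm (z - c)) \<le>
            ennreal (2 ^ Suc n) * indicator (cball c ((1 / 2) ^ n)) z"
          using n(2) True by (simp add: ennreal_leI)
        also have "\<dots> \<le> (\<Sum>n. ennreal (2 ^ Suc n) * indicator (cball c ((1 / 2) ^ n)) z)"
          by (rule ennreal_le_suminf)
        finally show ?thesis .
      qed auto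
    qed
    also have "\<dots> = H"
      unfolding H_def
      by (subst nn_integral_suminf)
        (auto intro!: borel_measurable_times_ennreal borel_measurable_indicator borel_closed
          simp: nn_integral_cmult_indicator emeasure_lborel_cball_complex)
    finally show ?thesis .
  qed
  ultimately show ?thesis
    by (intro exI[of _ "enn2real H"]) (auto simp: less_top)
qed

text \<open>The same device towards infinity: where the bracket is about \<open>2 ^ n\<close>, the
  integrand is at most \<open>(2 ^ n) powr (- b)\<close> on a disc of area
  \<open>4 * pi * 4 ^ n\<close>. The ratio of the series is \<open>2 powr (2 - b)\<close>, below 1
  since \<open>b > 2\<close>.\<close>

lemma nn_integral_japanese_bracket_finite:
  assumes b: "2 < b"
  shows "(\<integral>\<^sup>+z. ennreal (japanese_bracket z powr (- b)) \<partial>lborel) < \<infinity>"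
proof -
  have "(\<integral>\<^sup>+z. ennreal (japanese_bracket z powr (- b)) \<partial>lborel) \<le>
      (\<integral>\<^sup>+(z::complex). (\<Sum>n. ennreal ((2 ^ n) powr (- b)) * indicator (cball 0 (2 ^ Suc n)) z) \<partial>lborel)"
  proof (rule nn_integral_mono)
    fix z :: complex
    obtain n :: nat where n: "2 ^ n \<le> japanese_bracket z" "japanese_bracket z < 2 ^ Suc n"
      using dyadic_bracket[OF japanese_bracket_ge_1] .
    have "z \<in> cball 0 (2 ^ Suc n)"
      using n(2) norm_le_japanese_bracket[of z] by (simp add: dist_norm)
    moreover have "japanese_bracket z powr (- b) \<le> (2 ^ n) powr (- b)"
      using n(1) b by (intro powr_mono2') auto
    ultimately have "ennreal (japanese_bracket z powr (- b)) \<le>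
        ennreal ((2 ^ n) powr (- b)) * indicator (cball 0 (2 ^ Suc n)) z"
      by (simp add: ennreal_leI)
    also have "\<dots> \<le> (\<Sum>n. ennreal ((2 ^ n) powr (- b)) * indicator (cball 0 (2 ^ Suc n)) z)"
      by (rule ennreal_le_suminf)
    finally show "ennreal (japanese_bracket z powr (- b)) \<le>
        (\<Sum>n. ennreal ((2 ^ n) powr (- b)) * indicator (cball 0 (2 ^ Suc n)) z)" .
  qed
  also have "\<dots> = (\<Sum>n. ennreal ((2 ^ n) powr (- b)) * ennreal (pi * (2 ^ Suc n)\<^sup>2))"
  proof (subst nn_integral_suminf)
    show "(\<lambda>z. ennreal ((2 ^ n) powr (- b)) * indicator (cball 0 (2 ^ Suc n)) z) \<in> borel_measurable lborel" for n
      by (intro borel_measurable_times_ennreal borel_measurable_indicator) auto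
    show "(\<Sum>n. \<integral>\<^sup>+(z::complex). ennreal ((2 ^ n) powr (- b)) * indicator (cball 0 (2 ^ Suc n)) z \<partial>lborel) =
        (\<Sum>n. ennreal ((2 ^ n) powr (- b)) * ennreal (pi * (2 ^ Suc n)\<^sup>2))"
      by (intro suminf_cong, subst nn_integral_cmult_indicator, simp, subst emeasure_lborel_cball_complex) simp_all
  qed
  also have "\<dots> < \<infinity>"
  proof (rule suminf_geometric_finite)
    fix n :: nat
    have "((2::real) ^ n) powr (- b) * (pi * (2 ^ Suc n)\<^sup>2) = 4 * pi * ((2 powr (- b)) ^ n * 4 ^ n)"
      by (simp add: powr_powr powr_power power2_eq_square power_mult_distrib mult.commute flip: powr_realpow)
        (simp add: powr_realpow flip: power_mult_distrib)
    also have "\<dots> = 4 * pi * (2 powr (2 - b)) ^ n"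
      by (simp add: powr_diff powr_minus field_simps power_divide flip: power_mult_distrib)
    finally show "ennreal ((2 ^ n) powr (- b)) * ennreal (pi * (2 ^ Suc n)\<^sup>2) = ennreal (4 * pi * (2 powr (2 - b)) ^ n)"
      by (simp flip: ennreal_mult)
  next
    show "2 powr (2 - b) < 1" using b by (simp add: powr_less_one)
  qed auto
  finally show ?thesis .
qed


section \<open>Uniform bounds for integrals against a single Cauchy-type kernel\<close>

lemma indicator_ball_div_dist_measurable [measurable]:
  "(\<lambda>z. indicator (ball c r) z / norm (z - c) :: real) \<in> borel_measurable borel" for c :: complex
  by (intro borel_measurable_divide borel_measurable_indicator borel_open) auto

text \<open>The singularity costs at most \<open>H\<close> whatever \<open>c\<close> is. The decay
  in \<open>c\<close> comes from the bounded range of \<open>w\<close>: the bracket of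
  \<open>c\<close> is at most \<open>1 + R + norm (w - c)\<close>.\<close>

lemma nn_integral_inverse_dist_le:
  assumes R: "0 < R"
  shows "\<exists>C>0. \<forall>c::complex.
    (\<integral>\<^sup>+w. ennreal (indicator (ball 0 R) w / norm (c - w)) \<partial>lborel) \<le> ennreal (C / japanese_bracket c)"
proof -
  obtain H where H: "0 \<le> H"
    "\<And>c::complex. (\<integral>\<^sup>+z. ennreal (indicator (ball c 1) z / norm (z - c)) \<partial>lborel) \<le> ennreal H"
    using nn_integral_inverse_dist_ball_finite by blast
  define C where "C = (2 + R) * (pi * R\<^sup>2) + (1 + R) * H"
  have "0 < C" using R H(1) by (simp add: C_def add_pos_nonneg)
  moreover have "(\<integral>\<^sup>+w. ennreal (indicator (ball 0 R) w / norm (c - w)) \<partial>lborel) \<le> ennreal (C / japanese_bracket c)"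
    for c :: complex
  proof -
    let ?J = "japanese_bracket c"
    let ?h = "\<lambda>w. indicator (ball c 1) w / norm (w - c) :: real"
    have "(\<integral>\<^sup>+w. ennreal (indicator (ball 0 R) w / norm (c - w)) \<partial>lborel) \<le>
        (\<integral>\<^sup>+w. ennreal ((2 + R) / ?J) * indicator (cball 0 R) w + ennreal ((1 + R) / ?J) * ennreal (?h w) \<partial>lborel)"
    proof (rule nn_integral_mono)
      fix w :: complex
      have "indicator (ball 0 R) w / norm (c - w) \<le> (2 + R) / ?J * indicator (cball 0 R) w + (1 + R) / ?J * ?h w"
      proof (cases "w \<in> ball 0 R \<and> w \<noteq> c")
        case True
        then have w: "norm w < R" "0 < norm (w - c)" by auto
        \<comment> \<open>Either \<open>w\<close> is in the unit disc about \<open>c\<close>, where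
          \<open>?h w\<close> is the left side itself, or the distance is at least 1.\<close>
        have 1: "1 / norm (w - c) \<le> 1 + ?h w"
          using w by (auto simp: indicator_def dist_norm norm_minus_commute)
        have "?J \<le> 1 + R + norm (w - c)"
          using japanese_bracket_le[of c] norm_triangle_ineq2[of c w] w by (simp add: norm_minus_commute)
        \<comment> \<open>Multiplying by the bracket first lets the distance cancel; this produces
          the coefficients \<open>2 + R\<close> and \<open>1 + R\<close> of
          \<open>C\<close>.\<close>
        then have "?J * (1 / norm (w - c)) \<le> (1 + R + norm (w - c)) * (1 / norm (w - c))"
          by (rule mult_right_mono) simp
        also have "\<dots> = (1 + R) * (1 / norm (w - c)) + 1" using w by (simp add: field_simps)
        also have "\<dots> \<le> (1 + R) * (1 + ?h w) + 1" using 1 R by (intro add_right_mono mult_left_mono) auto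
        finally have "?J * (1 / norm (w - c)) \<le> (2 + R) + (1 + R) * ?h w" by (simp add: algebra_simps)
        then have "1 / norm (w - c) \<le> ((2 + R) + (1 + R) * ?h w) / ?J"
          using japanese_bracket_pos[of c] by (subst pos_le_divide_eq) (auto simp: mult.commute)
        also have "\<dots> = (2 + R) / ?J + (1 + R) / ?J * ?h w"
          by (simp only: add_divide_distrib[of "2 + R"] times_divide_eq_left)
        finally show ?thesis using True by (simp add: norm_minus_commute)
      qed (use R japanese_bracket_pos[of c] in auto)
      then show "ennreal (indicator (ball 0 R) w / norm (c - w)) \<le>
          ennreal ((2 + R) / ?J) * indicator (cball 0 R) w + ennreal ((1 + R) / ?J) * ennreal (?h w)"
        using R japanese_bracket_pos[of c]
        by (simp add: ennreal_leI flip: ennreal_mult ennreal_plus ennreal_indicator)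
    qed
    also have "\<dots> = ennreal ((2 + R) / ?J) * ennreal (pi * R\<^sup>2) + ennreal ((1 + R) / ?J) * (\<integral>\<^sup>+w. ennreal (?h w) \<partial>lborel)"
      using R by (subst nn_integral_add)
        (auto simp: nn_integral_cmult nn_integral_cmult_indicator emeasure_lborel_cball_complex
          intro!: borel_measurable_times_ennreal borel_measurable_indicator borel_closed)
    also have "\<dots> \<le> ennreal ((2 + R) / ?J) * ennreal (pi * R\<^sup>2) + ennreal ((1 + R) / ?J) * ennreal H"
      by (intro add_left_mono mult_left_mono H(2)) auto
    also have "\<dots> = ennreal (C / ?J)"
      using R H(1) japanese_bracket_pos[of c]
      by (simp add: C_def field_simps flip: ennreal_mult ennreal_plus)
    finally show ?thesis .
  qed
  ultimately show ?thesis by blast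
qed

text \<open>Inside the unit disc about \<open>c\<close> the bracket power is at most 1, leaving the
  local singularity. Outside it, the distance to \<open>c\<close> is at least the bracket divided by
  \<open>2 + R\<close>, so the integrand decays with exponent \<open>a + 1 > 2\<close>.\<close>

lemma nn_integral_japanese_bracket_inverse_dist_le:
  assumes R: "0 < R" and a: "1 < a"
  shows "\<exists>C\<ge>0. \<forall>c::complex \<in> ball 0 R.
    (\<integral>\<^sup>+z. ennreal (japanese_bracket z powr (- a) / norm (z - c)) \<partial>lborel) \<le> ennreal C"
proof -
  obtain H where H: "0 \<le> H"
    "\<And>c::complex. (\<integral>\<^sup>+z. ennreal (indicator (ball c 1) z / norm (z - c)) \<partial>lborel) \<le> ennreal H"
    using nn_integral_inverse_dist_ball_finite by blast
  define B where "B = (\<integral>\<^sup>+z. ennreal (japanese_bracket z powr (- (a + 1))) \<partial>lborel)"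
  have B: "B < \<infinity>"
    unfolding B_def by (rule nn_integral_japanese_bracket_finite) (use a in simp)
  have "(\<integral>\<^sup>+z. ennreal (japanese_bracket z powr (- a) / norm (z - c)) \<partial>lborel) \<le> ennreal H + ennreal (2 + R) * B"
    if c: "c \<in> ball 0 R" for c :: complex
  proof -
    let ?h = "\<lambda>w. indicator (ball c 1) w / norm (w - c) :: real"
    have "(\<integral>\<^sup>+z. ennreal (japanese_bracket z powr (- a) / norm (z - c)) \<partial>lborel) \<le>
      (\<integral>\<^sup>+z. ennreal (?h z) + ennreal (2 + R) * ennreal (japanese_bracket z powr (- (a + 1))) \<partial>lborel)"
    proof (rule nn_integral_mono)
      fix z :: complex
      let ?J = "japanese_bracket z"
      have J: "1 \<le> ?J" "0 < ?J" by (rule japanese_bracket_ge_1 japanese_bracket_pos)+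
      have "?J powr (- a) / norm (z - c) \<le> ?h z + (2 + R) * ?J powr (- (a + 1))"
      proof (cases "z \<in> ball c 1")
        case True
        have "?J powr (- a) \<le> ?J powr 0" using J a by (intro powr_mono) auto
        then have "?J powr (- a) / norm (z - c) \<le> 1 / norm (z - c)"
          using J by (intro divide_right_mono) auto
        then show ?thesis using True R by (simp add: add_increasing2)
      next
        case False
        then have d: "1 \<le> norm (z - c)" by (simp add: dist_norm norm_minus_commute)
        have "?J \<le> 1 + R + norm (z - c)"
          using japanese_bracket_le[of z] norm_triangle_ineq2[of z c] c by simp
        also have "\<dots> \<le> (2 + R) * norm (z - c)"
          using mult_left_mono[OF d, of "1 + R"] R by (simp add: algebra_simps)
        finally have "?J / norm (z - c) \<le> 2 + R"
          using d by (subst pos_divide_le_eq) auto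
        then have "1 / norm (z - c) \<le> (2 + R) / ?J"
          using J by (subst pos_le_divide_eq) auto
        then have "?J powr (- a) * (1 / norm (z - c)) \<le> ?J powr (- a) * ((2 + R) / ?J)"
          by (rule mult_left_mono) simp
        also have "\<dots> = (2 + R) * ?J powr (- (a + 1))"
          using J by (simp add: powr_diff)
        finally show ?thesis using False by simp
      qed
      then show "ennreal (?J powr (- a) / norm (z - c)) \<le>
          ennreal (?h z) + ennreal (2 + R) * ennreal (?J powr (- (a + 1)))"
        using R by (simp add: ennreal_leI flip: ennreal_mult ennreal_plus)
    qed
    also have "\<dots> = (\<integral>\<^sup>+z. ennreal (?h z) \<partial>lborel) + ennreal (2 + R) * B"
      unfolding B_def by (subst nn_integral_add) (auto simp: nn_integral_cmult)
    also have "\<dots> \<le> ennreal H + ennreal (2 + R) * B" by (intro add_right_mono H(2))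
    finally show ?thesis .
  qed
  moreover have "ennreal H + ennreal (2 + R) * B < \<infinity>"
    using B by (simp add: ennreal_mult_less_top)
  ultimately show ?thesis
    by (intro exI[of _ "enn2real (ennreal H + ennreal (2 + R) * B)"]) auto
qed

section \<open>The positive kernel dominating the operator\<close>

definition AB_kernel :: "complex set \<Rightarrow> complex \<Rightarrow> complex \<times> complex \<Rightarrow> real" where
  "AB_kernel \<Omega> z = (\<lambda>(\<zeta>, w). indicator \<Omega> \<zeta> * indicator \<Omega> w / (norm (z - \<zeta>) * norm (\<zeta> - w)))"

lemma AB_kernel_nonneg: "0 \<le> AB_kernel \<Omega> z x"
  by (simp add: AB_kernel_def split_beta)

text \<open>The exponent has the form \<open>cnj s - s\<close> with
  \<open>s = k * (\<zeta> - w)\<close>, hence is purely imaginary. Equality holds also on the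
  diagonals, where both sides vanish by the convention for division by zero.\<close>

lemma norm_AB_integrand:
  "norm (indicator (\<Omega> \<times> \<Omega>) x *\<^sub>R AB_integrand k u z x) = AB_kernel \<Omega> z x * norm (u (snd x))"
proof -
  have 1: "norm (exp (- k * (\<zeta> - w) + cnj k * (cnj \<zeta> - cnj w))) = 1" for \<zeta> w
    by (simp add: norm_exp_eq_Re algebra_simps)
  have 2: "norm (cnj \<zeta> - cnj w) = norm (\<zeta> - w)" for \<zeta> w
    by (metis complex_cnj_diff complex_mod_cnj)
  show ?thesis
    by (cases x) (simp only: AB_integrand_def AB_kernel_def prod.case snd_conv norm_scaleR norm_mult
      norm_divide 1 2 indicator_times, simp)
qed

text \<open>The products here are uncompleted products of completed measures. Coordinates viewed as
  Borel maps let the Borel operations in the kernel be composed with them.\<close>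

lemma lebesgue_coordinates_borel [measurable]:
  "(\<lambda>x. fst x) \<in> (lebesgue :: complex measure) \<Otimes>\<^sub>M N \<rightarrow>\<^sub>M borel"
  "(\<lambda>x. fst (snd x)) \<in> M \<Otimes>\<^sub>M ((lebesgue :: complex measure) \<Otimes>\<^sub>M N) \<rightarrow>\<^sub>M borel"
  "(\<lambda>x. snd (snd x)) \<in> M \<Otimes>\<^sub>M (N \<Otimes>\<^sub>M (lebesgue :: complex measure)) \<rightarrow>\<^sub>M borel"
  by (rule measurable_compose[OF _ id_lebesgue_borel]; measurable)+

lemma AB_kernel_measurable_triple:
  assumes [measurable]: "\<Omega> \<in> sets borel"
  shows "(\<lambda>x. AB_kernel \<Omega> (fst x) (snd x)) \<in> borel_measurable (lebesgue \<Otimes>\<^sub>M (lebesgue \<Otimes>\<^sub>M lebesgue))"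
  unfolding AB_kernel_def split_beta by measurable

lemma AB_kernel_measurable:
  assumes "\<Omega> \<in> sets borel"
  shows "AB_kernel \<Omega> z \<in> borel_measurable (lebesgue \<Otimes>\<^sub>M lebesgue)"
  using measurable_Pair2[OF AB_kernel_measurable_triple[OF assms], of z] by simp

text \<open>Joint measurability in \<open>z\<close> and the integration variables is what makes
  \<open>AB \<Omega> k u\<close>, an integral depending on the parameter \<open>z\<close>,
  measurable.\<close>

lemma AB_integrand_measurable_triple:
  assumes [measurable]: "\<Omega> \<in> sets borel" and u: "u \<in> borel_measurable lebesgue"
  shows "(\<lambda>x. indicator (\<Omega> \<times> \<Omega>) (snd x) *\<^sub>R AB_integrand k u (fst x) (snd x)) \<in>
    borel_measurable (lebesgue \<Otimes>\<^sub>M (lebesgue \<Otimes>\<^sub>M lebesgue))"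
proof -
  have [measurable]: "cnj \<in> borel_measurable borel"
    by (intro borel_measurable_continuous_onI continuous_intros)
  have [measurable]: "(\<lambda>x. u (snd (snd x))) \<in> borel_measurable (M \<Otimes>\<^sub>M (N \<Otimes>\<^sub>M lebesgue))"
    for M :: "'a measure" and N :: "'b measure"
    by (rule measurable_compose[OF _ u]) measurable
  have ind: "indicator (\<Omega> \<times> \<Omega>) (snd x) = (indicator \<Omega> (fst (snd x)) * indicator \<Omega> (snd (snd x)) :: real)"
    for x :: "complex \<times> complex \<times> complex"
    by (simp add: indicator_times)
  show ?thesis
    unfolding AB_integrand_def split_beta ind by measurable
qed

text \<open>Integrating in \<open>w\<close> first costs only a constant, since the bracket of
  \<open>\<zeta>\<close> is at least 1; the integral in \<open>\<zeta>\<close> then supplies the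
  decay in \<open>z\<close>.\<close>

lemma AB_kernel_mass_le:
  assumes [measurable]: "\<Omega> \<in> sets borel" and "\<Omega> \<subseteq> ball 0 R" and R: "0 < R"
  shows "\<exists>D>0. \<forall>z. (\<integral>\<^sup>+x. ennreal (AB_kernel \<Omega> z x) \<partial>(lebesgue \<Otimes>\<^sub>M lebesgue)) \<le> ennreal (D / japanese_bracket z)"
proof -
  obtain C where C: "0 < C"
    "\<And>c::complex. (\<integral>\<^sup>+w. ennreal (indicator (ball 0 R) w / norm (c - w)) \<partial>lborel) \<le> ennreal (C / japanese_bracket c)"
    using nn_integral_inverse_dist_le[OF R] by blast
  have le: "(\<integral>\<^sup>+w. ennreal (indicator \<Omega> w / norm (c - w)) \<partial>lebesgue) \<le> ennreal (C / japanese_bracket c)" for c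
    unfolding nn_integral_completion
    by (rule order_trans[OF nn_integral_mono C(2)])
      (use assms(2) in \<open>auto intro!: ennreal_leI divide_right_mono simp: indicator_def\<close>)
  have le1: "(\<integral>\<^sup>+w. ennreal (indicator \<Omega> w / norm (c - w)) \<partial>lebesgue) \<le> ennreal C" for c
    using le[of c] japanese_bracket_ge_1[of c] C(1)
    by (elim order_trans) (auto intro!: ennreal_leI simp: field_simps)
  have "(\<integral>\<^sup>+x. ennreal (AB_kernel \<Omega> z x) \<partial>(lebesgue \<Otimes>\<^sub>M lebesgue)) \<le> ennreal (C * C / japanese_bracket z)" for z
  proof -
    have "(\<integral>\<^sup>+x. ennreal (AB_kernel \<Omega> z x) \<partial>(lebesgue \<Otimes>\<^sub>M lebesgue)) =
      (\<integral>\<^sup>+\<zeta>. \<integral>\<^sup>+w. ennreal (AB_kernel \<Omega> z (\<zeta>, w)) \<partial>lebesgue \<partial>lebesgue)"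
      by (rule lebesgue.nn_integral_fst[symmetric]) (use AB_kernel_measurable in measurable)
    also have "\<dots> = (\<integral>\<^sup>+\<zeta>. ennreal (indicator \<Omega> \<zeta> / norm (z - \<zeta>)) *
        (\<integral>\<^sup>+w. ennreal (indicator \<Omega> w / norm (\<zeta> - w)) \<partial>lebesgue) \<partial>lebesgue)"
      by (intro nn_integral_cong, subst nn_integral_cmult[symmetric])
        (auto simp: AB_kernel_def simp flip: ennreal_mult)
    also have "\<dots> \<le> (\<integral>\<^sup>+\<zeta>. ennreal (indicator \<Omega> \<zeta> / norm (z - \<zeta>)) * ennreal C \<partial>lebesgue)"
      by (intro nn_integral_mono mult_left_mono le1) auto
    also have "\<dots> = (\<integral>\<^sup>+\<zeta>. ennreal (indicator \<Omega> \<zeta> / norm (z - \<zeta>)) \<partial>lebesgue) * ennreal C"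
      by (rule nn_integral_multc) measurable
    also have "\<dots> \<le> ennreal (C / japanese_bracket z) * ennreal C"
      by (intro mult_right_mono le) auto
    finally show ?thesis using C(1) japanese_bracket_pos[of z] by (simp flip: ennreal_mult)
  qed
  then show ?thesis using C(1) by (intro exI[of _ "C * C"]) auto
qed

text \<open>The other half of a Schur-type test: by Tonelli the integrations run in the order
  \<open>z\<close>, \<open>\<zeta>\<close>, \<open>w\<close>, and the first two are bounded
  uniformly in the remaining variables.\<close>

lemma AB_kernel_adjoint_le:
  assumes [measurable]: "\<Omega> \<in> sets borel" and \<Omega>: "\<Omega> \<subseteq> ball 0 R" and R: "0 < R" and a: "1 < a"
  shows "\<exists>K\<ge>0. \<forall>f. f \<in> borel_measurable lebesgue \<and> (\<forall>w. 0 \<le> f w) \<longrightarrow>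
    (\<integral>\<^sup>+z. ennreal (japanese_bracket z powr (- a)) *
        (\<integral>\<^sup>+x. ennreal (AB_kernel \<Omega> z x * f (snd x)) \<partial>(lebesgue \<Otimes>\<^sub>M lebesgue)) \<partial>lebesgue)
    \<le> ennreal K * (\<integral>\<^sup>+w. ennreal (f w) \<partial>lebesgue)"
proof -
  let ?L = "lebesgue :: complex measure"
  obtain A where A: "0 \<le> A" "\<And>c::complex. c \<in> ball 0 R \<Longrightarrow>
    (\<integral>\<^sup>+z. ennreal (japanese_bracket z powr (- a) / norm (z - c)) \<partial>lborel) \<le> ennreal A"
    using nn_integral_japanese_bracket_inverse_dist_le[OF R a] by blast
  obtain C where C: "0 < C"
    "\<And>c::complex. (\<integral>\<^sup>+w. ennreal (indicator (ball 0 R) w / norm (c - w)) \<partial>lborel) \<le> ennreal (C / japanese_bracket c)"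
    using nn_integral_inverse_dist_le[OF R] by blast
  have le1: "(\<integral>\<^sup>+\<zeta>. ennreal (indicator \<Omega> \<zeta> / norm (\<zeta> - w)) \<partial>lebesgue) \<le> ennreal C" for w
  proof -
    have "(\<integral>\<^sup>+\<zeta>. ennreal (indicator \<Omega> \<zeta> / norm (\<zeta> - w)) \<partial>lebesgue) \<le> ennreal (C / japanese_bracket w)"
      unfolding nn_integral_completion
      by (rule order_trans[OF nn_integral_mono C(2)])
        (use \<Omega> in \<open>auto intro!: ennreal_leI divide_right_mono simp: indicator_def norm_minus_commute\<close>)
    also have "\<dots> \<le> ennreal C"
      using japanese_bracket_ge_1[of w] C(1) by (auto intro!: ennreal_leI simp: field_simps)
    finally show ?thesis .
  qed
  interpret LL: sigma_finite_measure "?L \<Otimes>\<^sub>M ?L"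
    by (rule sigma_finite_pair_measure) (rule sigma_finite_lebesgue)+
  interpret P: pair_sigma_finite ?L ?L ..
  interpret PP: pair_sigma_finite ?L "?L \<Otimes>\<^sub>M ?L" ..
  have "(\<integral>\<^sup>+z. ennreal (japanese_bracket z powr (- a)) *
        (\<integral>\<^sup>+x. ennreal (AB_kernel \<Omega> z x * f (snd x)) \<partial>(lebesgue \<Otimes>\<^sub>M lebesgue)) \<partial>lebesgue)
    \<le> ennreal (A * C) * (\<integral>\<^sup>+w. ennreal (f w) \<partial>lebesgue)"
    if f [measurable]: "f \<in> borel_measurable lebesgue" and f0: "\<And>w. 0 \<le> f w" for f
  proof -
    note AB_kernel_measurable_triple[measurable] AB_kernel_measurable[measurable]
    have [measurable]: "(\<lambda>x. f (snd (snd x))) \<in> borel_measurable (?L \<Otimes>\<^sub>M (?L \<Otimes>\<^sub>M ?L))"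
      by (rule measurable_compose[OF _ f]) measurable
    have [measurable]: "(\<lambda>x. f (snd x)) \<in> borel_measurable (?L \<Otimes>\<^sub>M ?L)"
      by (rule measurable_compose[OF _ f]) measurable
    have [measurable]: "(\<lambda>x. snd x) \<in> ?L \<Otimes>\<^sub>M ?L \<rightarrow>\<^sub>M borel"
      by (rule measurable_compose[OF _ id_lebesgue_borel]) measurable
    let ?J = "\<lambda>z. japanese_bracket z powr (- a)"
    let ?g = "\<lambda>\<zeta> w. indicator \<Omega> \<zeta> / norm (\<zeta> - w) * f w"
    have g_meas [measurable]: "(\<lambda>x. ennreal (?g (fst x) (snd x))) \<in> borel_measurable (?L \<Otimes>\<^sub>M ?L)"
      by measurable
    have "(\<integral>\<^sup>+z. ennreal (?J z) * (\<integral>\<^sup>+x. ennreal (AB_kernel \<Omega> z x * f (snd x)) \<partial>(?L \<Otimes>\<^sub>M ?L)) \<partial>?L) =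
      (\<integral>\<^sup>+z. (\<integral>\<^sup>+x. ennreal (?J z) * ennreal (AB_kernel \<Omega> z x * f (snd x)) \<partial>(?L \<Otimes>\<^sub>M ?L)) \<partial>?L)"
      by (intro nn_integral_cong nn_integral_cmult[symmetric]) measurable
    \<comment> \<open>Tonelli for \<open>z\<close> against the pair
      \<open>x = (\<zeta>, w)\<close>.\<close>
    also have "\<dots> = (\<integral>\<^sup>+x. (\<integral>\<^sup>+z. ennreal (?J z) * ennreal (AB_kernel \<Omega> z x * f (snd x)) \<partial>?L) \<partial>(?L \<Otimes>\<^sub>M ?L))"
      by (rule PP.Fubini'[symmetric]) (simp add: split_beta)
    also have "\<dots> \<le> (\<integral>\<^sup>+x. ennreal A * ennreal (?g (fst x) (snd x)) \<partial>(?L \<Otimes>\<^sub>M ?L))"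
    proof (rule nn_integral_mono)
      fix x :: "complex \<times> complex"
      obtain \<zeta> w where x: "x = (\<zeta>, w)" by (cases x)
      show "(\<integral>\<^sup>+z. ennreal (?J z) * ennreal (AB_kernel \<Omega> z x * f (snd x)) \<partial>?L) \<le>
          ennreal A * ennreal (?g (fst x) (snd x))"
      proof (cases "\<zeta> \<in> \<Omega>")
        case True
        \<comment> \<open>For fixed \<open>\<zeta>\<close> and \<open>w\<close> only
          \<open>1 / norm (z - \<zeta>)\<close> depends on \<open>z\<close>; dropping the indicator
          of \<open>w\<close> leaves \<open>?g \<zeta> w\<close>.\<close>
        have "(\<integral>\<^sup>+z. ennreal (?J z) * ennreal (AB_kernel \<Omega> z x * f (snd x)) \<partial>?L) \<le>
            (\<integral>\<^sup>+z. ennreal (?J z / norm (z - \<zeta>)) * ennreal (?g \<zeta> w) \<partial>?L)"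
          by (rule nn_integral_mono)
            (use True f0 in \<open>auto simp: x AB_kernel_def indicator_def simp flip: ennreal_mult\<close>)
        also have "\<dots> = (\<integral>\<^sup>+z. ennreal (?J z / norm (z - \<zeta>)) \<partial>?L) * ennreal (?g \<zeta> w)"
          by (rule nn_integral_multc) measurable
        also have "\<dots> \<le> ennreal A * ennreal (?g \<zeta> w)"
          unfolding nn_integral_completion using True \<Omega> by (intro mult_right_mono A(2)) auto
        finally show ?thesis by (simp add: x)
      qed (simp add: x AB_kernel_def)
    qed
    also have "\<dots> = ennreal A * (\<integral>\<^sup>+x. ennreal (?g (fst x) (snd x)) \<partial>(?L \<Otimes>\<^sub>M ?L))"
      by (rule nn_integral_cmult) measurable
    also have "(\<integral>\<^sup>+x. ennreal (?g (fst x) (snd x)) \<partial>(?L \<Otimes>\<^sub>M ?L)) =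
        (\<integral>\<^sup>+w. (\<integral>\<^sup>+\<zeta>. ennreal (?g \<zeta> w) \<partial>?L) \<partial>?L)"
      using P.nn_integral_snd[OF g_meas] by simp
    also have "\<dots> = (\<integral>\<^sup>+w. (\<integral>\<^sup>+\<zeta>. ennreal (indicator \<Omega> \<zeta> / norm (\<zeta> - w)) \<partial>?L) * ennreal (f w) \<partial>?L)"
    proof (rule nn_integral_cong)
      fix w
      have "(\<integral>\<^sup>+\<zeta>. ennreal (?g \<zeta> w) \<partial>?L) =
          (\<integral>\<^sup>+\<zeta>. ennreal (indicator \<Omega> \<zeta> / norm (\<zeta> - w)) * ennreal (f w) \<partial>?L)"
        by (simp only: ennreal_mult''[OF f0])
      also have "\<dots> = (\<integral>\<^sup>+\<zeta>. ennreal (indicator \<Omega> \<zeta> / norm (\<zeta> - w)) \<partial>?L) * ennreal (f w)"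
        by (rule nn_integral_multc) measurable
      finally show "(\<integral>\<^sup>+\<zeta>. ennreal (?g \<zeta> w) \<partial>?L) = \<dots>" .
    qed
    also have "\<dots> \<le> (\<integral>\<^sup>+w. ennreal C * ennreal (f w) \<partial>?L)"
      by (intro nn_integral_mono mult_right_mono le1) auto
    also have "\<dots> = ennreal C * (\<integral>\<^sup>+w. ennreal (f w) \<partial>?L)"
      by (rule nn_integral_cmult) measurable
    finally show ?thesis
      using A(1) C(1) by (simp add: ennreal_mult mult.assoc mult_left_mono)
  qed
  then show ?thesis using A(1) C(1) by (intro exI[of _ "A * C"]) auto
qed

section \<open>The weighted estimate and its two special cases\<close>

lemma AB_weighted_Lp_bound:
  fixes p \<epsilon> :: real
  assumes "open \<Omega>" "bounded \<Omega>" and p: "1 < p" and \<epsilon>: "2 < p * (1 + \<epsilon>)"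
  shows "\<exists>C. \<forall>u\<in>Lp p. AB_well_defined \<Omega> k u \<and> AB \<Omega> k u \<in> weighted_Lp \<epsilon> p \<and>
    weighted_Lp_norm \<epsilon> p (AB \<Omega> k u) \<le> C * Lp_norm p u"
proof -
  let ?L = "lebesgue :: complex measure"
  let ?LL = "?L \<Otimes>\<^sub>M ?L"
  have \<Omega> [measurable]: "\<Omega> \<in> sets borel" using assms(1) by simp
  obtain R where R: "0 < R" "\<Omega> \<subseteq> ball 0 R"
    using bounded_subset_ballD[OF assms(2)] by blast
  \<comment> \<open>The exponent combines \<open>\<epsilon> * p\<close> from the weight with
    \<open>p - 1\<close> from the kernel mass in Hoelder's inequality; the hypothesis on
    \<open>\<epsilon>\<close> says exactly \<open>1 < a\<close>.\<close>
  define a where "a = p - 1 + \<epsilon> * p"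
  have a: "1 < a" using \<epsilon> by (simp add: a_def algebra_simps)
  obtain D where D: "0 < D"
    "\<And>z. (\<integral>\<^sup>+x. ennreal (AB_kernel \<Omega> z x) \<partial>?LL) \<le> ennreal (D / japanese_bracket z)"
    using AB_kernel_mass_le[OF \<Omega> R(2,1)] by blast
  obtain K where K: "0 \<le> K" "\<And>f. f \<in> borel_measurable lebesgue \<Longrightarrow> (\<And>w. 0 \<le> f w) \<Longrightarrow>
    (\<integral>\<^sup>+z. ennreal (japanese_bracket z powr (- a)) * (\<integral>\<^sup>+x. ennreal (AB_kernel \<Omega> z x * f (snd x)) \<partial>?LL) \<partial>?L)
    \<le> ennreal K * (\<integral>\<^sup>+w. ennreal (f w) \<partial>?L)"
    using AB_kernel_adjoint_le[OF \<Omega> R(2,1) a] by blast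
  interpret LL: sigma_finite_measure ?LL
    by (rule sigma_finite_pair_measure) (rule sigma_finite_lebesgue)+
  \<comment> \<open>The \<open>p\<close>-th power of the factor
    \<open>2 * D powr (1 - 1 / p)\<close> from Hoelder's inequality. The final constant
    \<open>(B * K) powr (1 / p)\<close> is thus fixed before \<open>u\<close>.\<close>
  define B where "B = 2 powr p * D powr (p - 1)"
  have B: "0 \<le> B" by (simp add: B_def)
  have "AB_well_defined \<Omega> k u \<and> AB \<Omega> k u \<in> weighted_Lp \<epsilon> p \<and>
      weighted_Lp_norm \<epsilon> p (AB \<Omega> k u) \<le> (B * K) powr (1 / p) * Lp_norm p u" if "u \<in> Lp p" for u
  proof -
    from that have u [measurable]: "u \<in> borel_measurable ?L" and ui: "integrable ?L (\<lambda>w. norm (u w) powr p)"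
      by (auto simp: Lp_def)
    define U where "U = (\<integral>w. norm (u w) powr p \<partial>?L)"
    have U0: "0 \<le> U" by (simp add: U_def)
    have U: "(\<integral>\<^sup>+w. ennreal (norm (u w) powr p) \<partial>?L) = ennreal U"
      unfolding U_def by (rule nn_integral_eq_integral[OF ui]) simp
    let ?J = "japanese_bracket"
    let ?F = "\<lambda>z x. indicator (\<Omega> \<times> \<Omega>) x *\<^sub>R AB_integrand k u z x"
    define I where "I z = (\<integral>\<^sup>+x. ennreal (AB_kernel \<Omega> z x * norm (u (snd x)) powr p) \<partial>?LL)" for z
    have [measurable]: "(\<lambda>x. u (snd x)) \<in> borel_measurable ?LL"
      by (rule measurable_compose[OF _ u]) measurable
    have [measurable]: "(\<lambda>x. u (snd (snd x))) \<in> borel_measurable (?L \<Otimes>\<^sub>M ?LL)"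
      by (rule measurable_compose[OF _ u]) measurable
    note [measurable] = AB_kernel_measurable AB_kernel_measurable_triple
    have [measurable]: "I \<in> borel_measurable ?L"
      unfolding I_def by (rule LL.borel_measurable_nn_integral) (simp add: split_beta)
    have F_meas: "?F z \<in> borel_measurable ?LL" for z
      using measurable_Pair2[OF AB_integrand_measurable_triple[OF \<Omega> u], of z k] by simp
    have AB_meas [measurable]: "AB \<Omega> k u \<in> borel_measurable ?L"
    proof -
      have "(\<lambda>z. \<integral>x. ?F z x \<partial>?LL) \<in> borel_measurable ?L"
        by (rule LL.borel_measurable_lebesgue_integral)
          (use AB_integrand_measurable_triple[OF \<Omega> u] in \<open>simp add: split_beta\<close>)
      then show ?thesis
        unfolding AB_def[abs_def] set_lebesgue_integral_def by measurable
    qed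
    have I_int: "(\<integral>\<^sup>+z. ennreal (?J z powr (- a)) * I z \<partial>?L) \<le> ennreal (K * U)"
      using K(2)[of "\<lambda>w. norm (u w) powr p"] K(1) U0
      by (simp add: I_def U ennreal_mult)
    \<comment> \<open>The weight is positive, so finiteness of the weighted integral forces
      \<open>I z\<close> to be finite almost everywhere; for such \<open>z\<close> the double
      integral converges absolutely.\<close>
    then have "AE z in ?L. ennreal (?J z powr (- a)) * I z \<noteq> \<infinity>"
      by (intro nn_integral_PInf_AE) (auto simp: top_unique)
    then have I_fin: "AE z in ?L. I z < \<infinity>"
      by eventually_elim
        (use japanese_bracket_pos in \<open>auto simp: ennreal_mult_eq_top_iff less_top less_imp_neq[THEN not_sym]\<close>)
    \<comment> \<open>Hoelder with the kernel as weight, whose mass is at most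
      \<open>D / ?J z\<close>.\<close>
    have F_le: "(\<integral>\<^sup>+x. ennreal (norm (?F z x)) \<partial>?LL) \<le>
        ennreal (2 * (D / ?J z) powr (1 - 1 / p) * enn2real (I z) powr (1 / p))" if "I z < \<infinity>" for z
      unfolding norm_AB_integrand using that D japanese_bracket_pos[of z]
      by (intro nn_integral_mult_powr_le p) (auto simp: AB_kernel_nonneg I_def)
    have F_int: "integrable ?LL (?F z)" if "I z < \<infinity>" for z
      using F_le[OF that] F_meas by (intro integrableI_bounded) (auto simp: le_less_trans)
    have wd: "AB_well_defined \<Omega> k u"
      unfolding AB_well_defined_def set_integrable_def
      using I_fin by eventually_elim (rule F_int)
    let ?G = "\<lambda>z. norm (of_real (?J z powr (- \<epsilon>)) * AB \<Omega> k u z) powr p"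
    have G_le: "ennreal (?G z) \<le> ennreal B * (ennreal (?J z powr (- a)) * I z)" if fin: "I z < \<infinity>" for z
    proof -
      note Jpos = japanese_bracket_pos[of z]
      define i where "i = enn2real (I z)"
      have i: "0 \<le> i" "I z = ennreal i" using fin by (auto simp: i_def)
      let ?E = "2 * (D / ?J z) powr (1 - 1 / p) * i powr (1 / p)"
      have "ennreal (norm (\<integral>x. ?F z x \<partial>?LL)) \<le> ennreal ?E"
        unfolding i_def by (rule order_trans[OF integral_norm_bound_ennreal[OF F_int[OF fin]] F_le[OF fin]])
      then have 1: "norm (\<integral>x. ?F z x \<partial>?LL) \<le> ?E"
        by (subst (asm) ennreal_le_iff) auto
      \<comment> \<open>The prefactor of \<open>AB\<close> has modulus at most 1 and is
        discarded.\<close>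
      have "1 \<le> pi ^ 2"
        using pi_gt3 by (intro one_le_power) simp
      then have "norm (1 / (4 * of_real pi ^ 2) :: complex) \<le> 1"
        by (simp add: norm_divide norm_mult norm_power)
      then have "norm (AB \<Omega> k u z) \<le> 1 * norm (\<integral>x. ?F z x \<partial>?LL)"
        unfolding AB_def set_lebesgue_integral_def norm_mult by (rule mult_right_mono) simp
      with 1 have "norm (AB \<Omega> k u z) \<le> ?E" by linarith
      then have "?G z \<le> (?J z powr (- \<epsilon>) * ?E) powr p"
        using p by (intro powr_mono2) (auto simp: norm_mult intro!: mult_left_mono)
      \<comment> \<open>Raising to the power \<open>p\<close> turns \<open>1 - 1 / p\<close> into
        \<open>p - 1\<close> and \<open>1 / p\<close> into 1, so \<open>i\<close> enters
        linearly.\<close>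
      also have "\<dots> = ?J z powr (- \<epsilon> * p) * (2 powr p * (D / ?J z) powr (p - 1) * i)"
        using p Jpos D(1) i(1) by (simp add: powr_mult powr_powr left_diff_distrib)
      also have "\<dots> = B * (?J z powr (- \<epsilon> * p) * ?J z powr (- (p - 1)) * i)"
        unfolding B_def powr_minus[of _ "p - 1"] using Jpos D(1)
        by (subst powr_divide) (auto simp: divide_inverse)
      also have "?J z powr (- \<epsilon> * p) * ?J z powr (- (p - 1)) = ?J z powr (- a)"
        unfolding powr_add[symmetric] by (simp add: a_def)
      finally have "ennreal (?G z) \<le> ennreal (B * (?J z powr (- a) * i))" by (rule ennreal_leI)
      then show ?thesis using B i by (simp add: ennreal_mult)
    qed
    have "(\<integral>\<^sup>+z. ennreal (?G z) \<partial>?L) \<le> (\<integral>\<^sup>+z. ennreal B * (ennreal (?J z powr (- a)) * I z) \<partial>?L)"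
      using I_fin by (intro nn_integral_mono_AE) (auto elim!: eventually_mono intro: G_le)
    also have "\<dots> = ennreal B * (\<integral>\<^sup>+z. ennreal (?J z powr (- a)) * I z \<partial>?L)"
      by (rule nn_integral_cmult) measurable
    also have "\<dots> \<le> ennreal B * ennreal (K * U)"
      by (intro mult_left_mono I_int) auto
    finally have G_int: "(\<integral>\<^sup>+z. ennreal (?G z) \<partial>?L) \<le> ennreal (B * K * U)"
      using B K(1) U0 by (simp add: ennreal_mult mult.assoc)
    have G_integrable: "integrable ?L ?G"
      using G_int by (intro integrableI_bounded) (auto simp: le_less_trans)
    then have mem: "AB \<Omega> k u \<in> weighted_Lp \<epsilon> p"
      by (simp add: weighted_Lp_def Lp_def)
    have "integral\<^sup>L ?L ?G \<le> B * K * U"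
      using G_int nn_integral_eq_integral[OF G_integrable] B K(1) U0 by (simp add: ennreal_le_iff)
    then have "weighted_Lp_norm \<epsilon> p (AB \<Omega> k u) \<le> (B * K * U) powr (1 / p)"
      unfolding weighted_Lp_norm_def Lp_norm_def using p by (intro powr_mono2) auto
    then have "weighted_Lp_norm \<epsilon> p (AB \<Omega> k u) \<le> (B * K) powr (1 / p) * Lp_norm p u"
      using B K(1) U0 by (simp add: Lp_norm_def U_def powr_mult)
    with wd mem show ?thesis by blast
  qed
  then show ?thesis by blast
qed

theorem theorem0p1:
  fixes \<Omega> :: "complex set" and k :: complex
  assumes "open \<Omega>" and "connected \<Omega>" and "\<Omega> \<noteq> {}" and "bounded \<Omega>"
    and "locally_Lipschitz_graph (frontier \<Omega>)"
  shows "(\<forall>p::real. 2 < p \<longrightarrow>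
            (\<exists>C::real. \<forall>u\<in>Lp p.
               AB_well_defined \<Omega> k u \<and> AB \<Omega> k u \<in> Lp p \<and>
               Lp_norm p (AB \<Omega> k u) \<le> C * Lp_norm p u)) \<and>
         (\<forall>(p::real) \<epsilon>::real. 1 < p \<and> p \<le> 2 \<and> \<epsilon> > 2 / p - 1 \<longrightarrow>
            (\<exists>C::real. \<forall>u\<in>Lp p.
               AB_well_defined \<Omega> k u \<and> AB \<Omega> k u \<in> weighted_Lp \<epsilon> p \<and>
               weighted_Lp_norm \<epsilon> p (AB \<Omega> k u) \<le> C * Lp_norm p u))"
proof (intro conjI allI impI)
  fix p :: real assume "2 < p"
  \<comment> \<open>With \<open>\<epsilon> = 0\<close> the weight is 1; positivity matters because
    \<open>0 powr 0\<close> is 0 in HOL.\<close>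
  moreover have "japanese_bracket z powr 0 = 1" for z
    using japanese_bracket_pos[of z] by simp
  ultimately show "\<exists>C::real. \<forall>u\<in>Lp p. AB_well_defined \<Omega> k u \<and> AB \<Omega> k u \<in> Lp p \<and>
      Lp_norm p (AB \<Omega> k u) \<le> C * Lp_norm p u"
    using AB_weighted_Lp_bound[OF assms(1,4), of p 0 k]
    by (simp add: weighted_Lp_def weighted_Lp_norm_def)
next
  fix p \<epsilon> :: real assume "1 < p \<and> p \<le> 2 \<and> \<epsilon> > 2 / p - 1"
  then show "\<exists>C::real. \<forall>u\<in>Lp p. AB_well_defined \<Omega> k u \<and> AB \<Omega> k u \<in> weighted_Lp \<epsilon> p \<and>
      weighted_Lp_norm \<epsilon> p (AB \<Omega> k u) \<le> C * Lp_norm p u"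
    \<comment> \<open>Multiplying \<open>\<epsilon> > 2 / p - 1\<close> by the positive
      \<open>p\<close> gives \<open>2 < p * (1 + \<epsilon>)\<close>.\<close>
    by (intro AB_weighted_Lp_bound assms) (auto simp: field_simps)
qed

end
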